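(* Let $(N,v)$ be a simple game and let $v^*$ be its dual game. Then $R_{\mathrm{LRM}}^{v}=R_{\mathrm{crit}}^{v^*}$, i.e. the LRM ranking of $v$ coincides with the criticality-based ranking of $v^*$.
   Context: A simple game on $N=\{1,\dots,n\}$ is a function $v:2^N\to\{0,1\}$ with $v(\varnothing)=0$, $v(N)=1$ and $v(S)\le v(T)$ whenever $S\subseteq T\subseteq N$. A coalition $S\subseteq N$ is winning if $v(S)=1$; $\mathcal{W}^v$ is the set of winning coalitions and $\mathcal{W}^v_{\min}$ the set of its inclusion-minimal elements. A coalition $B\subseteq N$ is blocking (for $N$) if $v(N\setminus B)=0$; $\mathcal{B}^v$ is the set of blocking coalitions and $\mathcal{B}^v_{\min}$ the set of its inclusion-minimal elements. The dual game $v^*$ is defined by $v^*(S)=v(N)-v(N\setminus S)$ for all $S\subseteq N$ (it is again a simple game). For real vectors, $\mathbf{x}\ge_L\mathbf{y}$ means that either $\mathbf{x}=\mathbf{y}$ or there is $k$ with $x_t=y_t$ for $t=1,\dots,k-1$ and $x_k>y_k$. LRM (Lexicographic Ranking based on Minimal winning coalitions): for $i\in N$ let $\theta_v(i)=(i_1,\dots,i_n)$ with $i_k=|\{S\in\mathcal{W}^v_{\min}: i\in S, |S|=k\}|$; then $R_{\mathrm{LRM}}^v$ is the total preorder on $N$ given by $i\,R_{\mathrm{LRM}}^v\,j$ iff $\theta_v(i)\ge_L\theta_v(j)$. Criticality-based ranking: for $i\in N$ let $\theta^*_v(i)=(i^*_1,\dots,i^*_n)$ with $i^*_k=|\{B\in\mathcal{B}^v_{\min}: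 i\in B, |B|=k\}|$; then $R_{\mathrm{crit}}^v$ is the total preorder on $N$ given by $i\,R_{\mathrm{crit}}^v\,j$ iff $\theta^*_v(i)\ge_L\theta^*_v(j)$. *)

theory Defs
  imports Complex_Main
begin

definition players :: "nat \<Rightarrow> nat set"
  where "players n = {1..n}"

(* Games are total functions on sets of naturals; only the values on subsets of
   "players n" are constrained, and only those are used below. The codomain is int
   so that the subtraction in the dual game does not truncate. *)
definition simple_game :: "nat \<Rightarrow> (nat set \<Rightarrow> int) \<Rightarrow> bool"
  where "simple_game n v \<longleftrightarrow>
    (\<forall>S. S \<subseteq> players n \<longrightarrow> v S \<in> {0, 1}) \<and>
    v {} = 0 \<and> v (players n) = 1 \<and>
    (\<forall>S T. S \<subseteq> T \<and> T \<subseteq> players n \<longrightarrow> v S \<le> v T)"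

definition winning :: "nat \<Rightarrow> (nat set \<Rightarrow> int) \<Rightarrow> nat set set"
  where "winning n v = {S. S \<subseteq> players n \<and> v S = 1}"

definition blocking :: "nat \<Rightarrow> (nat set \<Rightarrow> int) \<Rightarrow> nat set set"
  where "blocking n v = {B. B \<subseteq> players n \<and> v (players n - B) = 0}"

definition minimal_sets :: "'a set set \<Rightarrow> 'a set set"
  where "minimal_sets F = {S \<in> F. \<forall>T \<in> F. T \<subseteq> S \<longrightarrow> T = S}"

definition dual_game :: "nat \<Rightarrow> (nat set \<Rightarrow> int) \<Rightarrow> nat set \<Rightarrow> int"
  where "dual_game n v S = v (players n) - v (players n - S)"

lemma simple_game_dual_game:
  assumes "simple_game n v"
  shows "simple_game n (dual_game n v)"
proof -
  have v01: "v (players n - S) = 0 \<or> v (players n - S) = 1" for S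
  proof -
    have "players n - S \<subseteq> players n" by (rule Diff_subset)
    then have "v (players n - S) \<in> {0, 1}" using assms unfolding simple_game_def by meson
    then show ?thesis by simp
  qed
  have empty: "v {} = 0" and full: "v (players n) = 1"
    using assms unfolding simple_game_def by meson+
  have mono: "v (players n - T) \<le> v (players n - S)" if "S \<subseteq> T" for S T
  proof -
    have "players n - T \<subseteq> players n - S" using that by (rule Diff_mono[OF subset_refl])
    moreover have "players n - S \<subseteq> players n" by (rule Diff_subset)
    ultimately show ?thesis using assms unfolding simple_game_def by meson
  qed
  show ?thesis
    unfolding simple_game_def dual_game_def
  proof (intro conjI allI impI)
    show "v (players n) - v (players n - S) \<in> {0, 1}" for S
      using v01[of S] by (elim disjE) (simp_all add: full)
    show "v (players n) - v (players n - S) \<le> v (players n) - v (players n - T)"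
      if "S \<subseteq> T \<and> T \<subseteq> players n" for S T
      using mono[of S T] that by linarith
  qed (simp_all add: empty full)
qed

(* A vector (x 1, ..., x n) is a function of which only the arguments 1, ..., n matter. *)
definition lex_ge :: "nat \<Rightarrow> (nat \<Rightarrow> real) \<Rightarrow> (nat \<Rightarrow> real) \<Rightarrow> bool"
  where "lex_ge n x y \<longleftrightarrow>
    (\<forall>t \<in> {1..n}. x t = y t) \<or>
    (\<exists>k \<in> {1..n}. (\<forall>t \<in> {1..<k}. x t = y t) \<and> x k > y k)"

definition theta :: "nat \<Rightarrow> (nat set \<Rightarrow> int) \<Rightarrow> nat \<Rightarrow> nat \<Rightarrow> real"
  where "theta n v i k = real (card {S \<in> minimal_sets (winning n v). i \<in> S \<and> card S = k})"

definition theta_crit :: "nat \<Rightarrow> (nat set \<Rightarrow> int) \<Rightarrow> nat \<Rightarrow> nat \<Rightarrow> real"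
  where "theta_crit n v i k = real (card {B \<in> minimal_sets (blocking n v). i \<in> B \<and> card B = k})"

definition R_LRM :: "nat \<Rightarrow> (nat set \<Rightarrow> int) \<Rightarrow> nat rel"
  where "R_LRM n v =
    {(i, j). i \<in> players n \<and> j \<in> players n \<and> lex_ge n (theta n v i) (theta n v j)}"

definition R_crit :: "nat \<Rightarrow> (nat set \<Rightarrow> int) \<Rightarrow> nat rel"
  where "R_crit n v =
    {(i, j). i \<in> players n \<and> j \<in> players n \<and> lex_ge n (theta_crit n v i) (theta_crit n v j)}"

end

theory Submission
  imports Defs
begin

text \<open>Complementing twice returns the coalition, so v*(N - B) = v(N) - v(B) = 1 - v(B): B
  blocks in v* exactly when B wins in v. By \<open>blocking_dual_game\<close> both rankings thus
  count the same minimal coalitions.\<close>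

lemma blocking_dual_game:
  assumes "simple_game n v"
  shows "blocking n (dual_game n v) = winning n v"
proof -
  have "v (players n) = 1"
    using assms unfolding simple_game_def by blast
  then have "dual_game n v (players n - S) = 1 - v S" if "S \<subseteq> players n" for S
    using that by (simp add: dual_game_def double_diff)
  then show ?thesis
    by (auto simp: blocking_def winning_def)
qed

theorem proposition3:
  fixes n :: nat and v :: "nat set \<Rightarrow> int"
  assumes "simple_game n v"
  shows "R_LRM n v = R_crit n (dual_game n v)"
proof -
  \<comment> \<open>The count vectors themselves agree, for every player and size, so
    \<open>lex_ge\<close> need not be unfolded.\<close>
  have "theta_crit n (dual_game n v) = theta n v"
    by (intro ext) (simp add: theta_def theta_crit_def blocking_dual_game[OF assms])
  then show ?thesis
    by (simp add: R_LRM_def R_crit_def)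
qed

end
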